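(* Let $\{(G_n,r_n),g_n^{n+1}\}_{n\in\mathbb{N}}$ and $\{(H_n,s_n),h_n^{n+1}\}_{n\in\mathbb{N}}$ be g-cell structures and let $f\colon G_\infty\to H_\infty$ be a weak g-cell map. Then $f$ induces a (well-defined) function $\widehat{f}\colon G^\ast\to H^\ast$ given by $\widehat{f}([\overline{x}])=[f(\overline{x})]$. If in addition $f$ is continuous, then $\widehat{f}$ is continuous.
   Context: $\mathbb{N}=\{1,2,3,\dots\}$. A cellular graph is a pair $(G,r)$ with $G$ a non-empty topological space and $r\subset G\times G$ a reflexive and symmetric relation. An inverse sequence of cellular graphs $\{(G_n,r_n),g_n^{n+1}\}_{n\in\mathbb{N}}$ consists of cellular graphs $(G_n,r_n)$ and continuous bonding maps $g_n^{n+1}\colon G_{n+1}\to G_n$ with $(g_n^{n+1}(x),g_n^{n+1}(y))\in r_n$ whenever $(x,y)\in r_{n+1}$; $g_n^m\colon G_m\to G_n$ ($n\le m$) denotes the composite, with $g_n^n$ the identity. Its inverse limit is $G_\infty=\{\overline{x}=(x_n)_{n}\in\prod_n G_n : g_i^j(x_j)=x_i \text{ for all } j\ge i\}$ with the subspace topology of the product topology. The natural relation on $G_\infty$ is $r=\{(\overline{x},\overline{y}) : (x_n,y_n)\in r_n \ \forall n\in\mathbb{N}\}$. The inverse sequence is a g-cell structure if $r$ is an equivalence relation. In that case $G^\ast=G_\infty/r$ with the quotient topology, and $[\overline{x}]\in G^\ast$ is the class of $\overline{x}$. Analogously $H_\infty$, $s$ and $H^\ast=H_\infty/s$ are obtained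 from $\{(H_n,s_n),h_n^{n+1}\}$. A weak g-cell map is a function $f\colon G_\infty\to H_\infty$ such that $(\overline{x},\overline{y})\in r$ implies $(f(\overline{x}),f(\overline{y}))\in s$. *)

theory Defs
  imports "HOL-Analysis.Analysis"
begin

definition cellular_graph :: "'a topology \<Rightarrow> 'a rel \<Rightarrow> bool" where
  "cellular_graph X r \<longleftrightarrow>
     topspace X \<noteq> {} \<and> r \<subseteq> topspace X \<times> topspace X \<and> refl_on (topspace X) r \<and> sym r"

text \<open>Sequences are indexed by the positive integers; index \<open>0\<close> is never used.
  The bonding map from the space with index \<open>n + 1\<close> to the one with index \<open>n\<close> is \<open>g n\<close>.\<close>

definition inverse_sequence ::
    "(nat \<Rightarrow> 'a topology) \<Rightarrow> (nat \<Rightarrow> 'a rel) \<Rightarrow> (nat \<Rightarrow> 'a \<Rightarrow> 'a) \<Rightarrow> bool" where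
  "inverse_sequence G r g \<longleftrightarrow>
     (\<forall>n\<ge>1. cellular_graph (G n) (r n) \<and>
            continuous_map (G (Suc n)) (G n) (g n) \<and>
            (\<forall>x y. (x, y) \<in> r (Suc n) \<longrightarrow> (g n x, g n y) \<in> r n))"

text \<open>For \<open>n \<le> m\<close>, \<open>bond g n m\<close> is the composite \<open>g n \<circ> \<dots> \<circ> g (m - 1)\<close>
  from the space with index \<open>m\<close> to the one with index \<open>n\<close>; its value for \<open>n > m\<close> is irrelevant.\<close>

primrec bond :: "(nat \<Rightarrow> 'a \<Rightarrow> 'a) \<Rightarrow> nat \<Rightarrow> nat \<Rightarrow> 'a \<Rightarrow> 'a" where
  "bond g n 0 = id"
| "bond g n (Suc m) = (if n \<le> m then bond g n m \<circ> g m else id)"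

definition inverse_limit ::
    "(nat \<Rightarrow> 'a topology) \<Rightarrow> (nat \<Rightarrow> 'a \<Rightarrow> 'a) \<Rightarrow> (nat \<Rightarrow> 'a) topology" where
  "inverse_limit G g =
     subtopology (product_topology G {1..})
       {x. \<forall>i\<ge>1. \<forall>j\<ge>i. bond g i j (x j) = x i}"

definition natural_relation ::
    "(nat \<Rightarrow> 'a topology) \<Rightarrow> (nat \<Rightarrow> 'a rel) \<Rightarrow> (nat \<Rightarrow> 'a \<Rightarrow> 'a) \<Rightarrow> (nat \<Rightarrow> 'a) rel" where
  "natural_relation G r g =
     {(x, y). x \<in> topspace (inverse_limit G g) \<and> y \<in> topspace (inverse_limit G g) \<and>
              (\<forall>n\<ge>1. (x n, y n) \<in> r n)}"

definition g_cell_structure ::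
    "(nat \<Rightarrow> 'a topology) \<Rightarrow> (nat \<Rightarrow> 'a rel) \<Rightarrow> (nat \<Rightarrow> 'a \<Rightarrow> 'a) \<Rightarrow> bool" where
  "g_cell_structure G r g \<longleftrightarrow>
     inverse_sequence G r g \<and>
     equiv (topspace (inverse_limit G g)) (natural_relation G r g)"

definition quotient_topology :: "'a topology \<Rightarrow> 'a rel \<Rightarrow> 'a set topology" where
  "quotient_topology X r =
     topology (\<lambda>U. U \<subseteq> topspace X // r \<and> openin X {x \<in> topspace X. r `` {x} \<in> U})"

lemma openin_quotient_topology:
  "openin (quotient_topology X r) U \<longleftrightarrow>
     U \<subseteq> topspace X // r \<and> openin X {x \<in> topspace X. r `` {x} \<in> U}"
proof -
  let ?P = "\<lambda>U. U \<subseteq> topspace X // r \<and> openin X {x \<in> topspace X. r `` {x} \<in> U}"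
  have "istopology ?P"
    unfolding istopology_def
  proof (intro conjI allI impI)
    fix S T assume "?P S" "?P T"
    moreover have "{x \<in> topspace X. r `` {x} \<in> S \<inter> T} =
        {x \<in> topspace X. r `` {x} \<in> S} \<inter> {x \<in> topspace X. r `` {x} \<in> T}"
      by auto
    ultimately show "S \<inter> T \<subseteq> topspace X // r"
      and "openin X {x \<in> topspace X. r `` {x} \<in> S \<inter> T}"
      by auto
  next
    fix K assume K: "\<forall>S\<in>K. ?P S"
    then show "\<Union>K \<subseteq> topspace X // r" by blast
    have "{x \<in> topspace X. r `` {x} \<in> \<Union>K} = (\<Union>S\<in>K. {x \<in> topspace X. r `` {x} \<in> S})"
      by auto
    then show "openin X {x \<in> topspace X. r `` {x} \<in> \<Union>K}"
      using K by auto
  qed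
  then show ?thesis
    by (simp add: quotient_topology_def topology_inverse')
qed

lemma topspace_quotient_topology:
  "topspace (quotient_topology X r) = topspace X // r"
proof -
  have "{x \<in> topspace X. r `` {x} \<in> topspace X // r} = topspace X"
    by (auto intro: quotientI)
  then have "openin (quotient_topology X r) (topspace X // r)"
    by (simp add: openin_quotient_topology)
  then show ?thesis
    by (meson openin_quotient_topology openin_subset openin_topspace subset_antisym)
qed

lemma quotient_map_quotient_topology:
  "quotient_map X (quotient_topology X r) (\<lambda>x. r `` {x})"
  by (auto simp: quotient_map_def topspace_quotient_topology openin_quotient_topology quotient_def)

definition quotient_space ::
    "(nat \<Rightarrow> 'a topology) \<Rightarrow> (nat \<Rightarrow> 'a rel) \<Rightarrow> (nat \<Rightarrow> 'a \<Rightarrow> 'a) \<Rightarrow> (nat \<Rightarrow> 'a) set topology" where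
  "quotient_space G r g = quotient_topology (inverse_limit G g) (natural_relation G r g)"

definition weak_g_cell_map ::
    "(nat \<Rightarrow> 'a topology) \<Rightarrow> (nat \<Rightarrow> 'a rel) \<Rightarrow> (nat \<Rightarrow> 'a \<Rightarrow> 'a) \<Rightarrow>
     (nat \<Rightarrow> 'b topology) \<Rightarrow> (nat \<Rightarrow> 'b rel) \<Rightarrow> (nat \<Rightarrow> 'b \<Rightarrow> 'b) \<Rightarrow>
     ((nat \<Rightarrow> 'a) \<Rightarrow> (nat \<Rightarrow> 'b)) \<Rightarrow> bool" where
  "weak_g_cell_map G r g H s h f \<longleftrightarrow>
     f \<in> topspace (inverse_limit G g) \<rightarrow> topspace (inverse_limit H h) \<and>
     (\<forall>x y. (x, y) \<in> natural_relation G r g \<longrightarrow> (f x, f y) \<in> natural_relation H s h)"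

text \<open>A function between the quotient spaces is represented by its extensional HOL function,
  so that equality of HOL functions is equality of functions between the quotients.\<close>

definition induced_map ::
    "(nat \<Rightarrow> 'a topology) \<Rightarrow> (nat \<Rightarrow> 'a rel) \<Rightarrow> (nat \<Rightarrow> 'a \<Rightarrow> 'a) \<Rightarrow>
     (nat \<Rightarrow> 'b topology) \<Rightarrow> (nat \<Rightarrow> 'b rel) \<Rightarrow> (nat \<Rightarrow> 'b \<Rightarrow> 'b) \<Rightarrow>
     ((nat \<Rightarrow> 'a) \<Rightarrow> (nat \<Rightarrow> 'b)) \<Rightarrow> ((nat \<Rightarrow> 'a) set \<Rightarrow> (nat \<Rightarrow> 'b) set) \<Rightarrow> bool" where
  "induced_map G r g H s h f F \<longleftrightarrow>
     F \<in> topspace (quotient_space G r g) \<rightarrow>\<^sub>E topspace (quotient_space H s h) \<and>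
     (\<forall>x \<in> topspace (inverse_limit G g).
        F (natural_relation G r g `` {x}) = natural_relation H s h `` {f x})"

end

theory Submission
  imports Defs
begin

text \<open>
  This is the universal property of the quotient of \<open>G\<^sub>\<infinity>\<close> by its natural relation. A weak g-cell
  map sends related points to related points, so all representatives of a class have images in one
  and the same class; this makes the induced function exist
  (\<open>respectful_map_factors_through_classes\<close>), and it is unique because every point of the quotient
  is the class of some point of \<open>G\<^sub>\<infinity>\<close>. For continuity (\<open>continuous_map_between_quotients\<close>), the
  projection of \<open>G\<^sub>\<infinity>\<close> onto its quotient followed by the induced function equals \<open>f\<close> followed by the
  projection of \<open>H\<^sub>\<infinity>\<close> onto its quotient, which is continuous if \<open>f\<close> is; since the former projection
  is a quotient map, the induced function is continuous itself.
\<close>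

text \<open>
  Taking the union of the classes of the images of all representatives of a class avoids choosing
  one; by transitivity of the target relation the union is a single class.
\<close>

lemma respectful_map_factors_through_classes:
  assumes R: "equiv A R" and S: "equiv B S"
    and f: "f \<in> A \<rightarrow> B"
    and resp: "\<And>x y. (x, y) \<in> R \<Longrightarrow> (f x, f y) \<in> S"
  shows "\<exists>!F. F \<in> A // R \<rightarrow>\<^sub>E B // S \<and> (\<forall>x\<in>A. F (R `` {x}) = S `` {f x})"
proof (rule ex_ex1I)
  let ?F = "restrict (\<lambda>c. S `` (f ` c)) (A // R)"
  have union_is_class: "S `` (f ` (R `` {x})) = S `` {f x}" if "x \<in> A" for x
  proof -
    have "S `` {f y} = S `` {f x}" if "y \<in> R `` {x}" for y
      using that resp equiv_class_eq [OF S] by blast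
    moreover have "x \<in> R `` {x}"
      using equiv_class_self [OF R \<open>x \<in> A\<close>] .
    ultimately show ?thesis by blast
  qed
  have "?F (R `` {x}) = S `` {f x}" if "x \<in> A" for x
    using that by (simp add: quotientI union_is_class)
  moreover have "?F \<in> A // R \<rightarrow>\<^sub>E B // S"
  proof (rule restrict_PiE_iff [THEN iffD2], rule ballI)
    fix c assume "c \<in> A // R"
    then obtain x where "x \<in> A" "c = R `` {x}"
      by (rule quotientE)
    then show "S `` (f ` c) \<in> B // S"
      using f by (auto simp: union_is_class intro: quotientI)
  qed
  ultimately show "\<exists>F. F \<in> A // R \<rightarrow>\<^sub>E B // S \<and> (\<forall>x\<in>A. F (R `` {x}) = S `` {f x})"
    by blast
next
  fix F F'
  assume F: "F \<in> A // R \<rightarrow>\<^sub>E B // S \<and> (\<forall>x\<in>A. F (R `` {x}) = S `` {f x})"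
    and F': "F' \<in> A // R \<rightarrow>\<^sub>E B // S \<and> (\<forall>x\<in>A. F' (R `` {x}) = S `` {f x})"
  show "F = F'"
  proof (rule PiE_ext)
    show "F \<in> A // R \<rightarrow>\<^sub>E B // S" "F' \<in> A // R \<rightarrow>\<^sub>E B // S"
      using F F' by auto
    fix c assume "c \<in> A // R"
    then obtain x where "x \<in> A" "c = R `` {x}"
      by (rule quotientE)
    then show "F c = F' c"
      using F F' by simp
  qed
qed

lemma continuous_map_between_quotients:
  assumes f: "continuous_map X Y f"
    and F: "\<And>x. x \<in> topspace X \<Longrightarrow> F (R `` {x}) = S `` {f x}"
  shows "continuous_map (quotient_topology X R) (quotient_topology Y S) F"
proof (rule continuous_compose_quotient_map [OF quotient_map_quotient_topology])
  have "continuous_map X (quotient_topology Y S) ((\<lambda>y. S `` {y}) \<circ> f)"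
    using f quotient_imp_continuous_map [OF quotient_map_quotient_topology]
    by (rule continuous_map_compose)
  then show "continuous_map X (quotient_topology Y S) (F \<circ> (\<lambda>x. R `` {x}))"
    by (rule continuous_map_eq) (simp add: F)
qed

theorem theorem2p3:
  fixes G :: "nat \<Rightarrow> 'a topology" and r :: "nat \<Rightarrow> 'a rel" and g :: "nat \<Rightarrow> 'a \<Rightarrow> 'a"
    and H :: "nat \<Rightarrow> 'b topology" and s :: "nat \<Rightarrow> 'b rel" and h :: "nat \<Rightarrow> 'b \<Rightarrow> 'b"
    and f :: "(nat \<Rightarrow> 'a) \<Rightarrow> (nat \<Rightarrow> 'b)"
  assumes "g_cell_structure G r g"
    and "g_cell_structure H s h"
    and "weak_g_cell_map G r g H s h f"
  shows "(\<exists>!F. induced_map G r g H s h f F) \<and>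
    (continuous_map (inverse_limit G g) (inverse_limit H h) f \<longrightarrow>
      (\<forall>F. induced_map G r g H s h f F \<longrightarrow>
           continuous_map (quotient_space G r g) (quotient_space H s h) F))"
proof (intro conjI impI allI)
  have "equiv (topspace (inverse_limit G g)) (natural_relation G r g)"
    and "equiv (topspace (inverse_limit H h)) (natural_relation H s h)"
    using assms(1,2) by (auto simp: g_cell_structure_def)
  moreover have "f \<in> topspace (inverse_limit G g) \<rightarrow> topspace (inverse_limit H h)"
    and "\<And>x y. (x, y) \<in> natural_relation G r g \<Longrightarrow> (f x, f y) \<in> natural_relation H s h"
    using assms(3) by (auto simp: weak_g_cell_map_def)
  ultimately show "\<exists>!F. induced_map G r g H s h f F"
    unfolding induced_map_def quotient_space_def topspace_quotient_topology
    by (rule respectful_map_factors_through_classes)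
next
  fix F
  assume "continuous_map (inverse_limit G g) (inverse_limit H h) f"
    and "induced_map G r g H s h f F"
  then show "continuous_map (quotient_space G r g) (quotient_space H s h) F"
    unfolding quotient_space_def induced_map_def
    by (blast intro: continuous_map_between_quotients)
qed

end
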